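(* Let $G$ be a group-groupoid and let $(A,B,\alpha)$ be the crossed module corresponding to $G$, i.e. $A=\operatorname{Ker}d_0$, $B=\operatorname{Ob}(G)$, $\alpha=d_1|_A$, with action $b\cdot a=1_b+a-1_b$. Then the category $\mathsf{GpGpdAct}(G)$ of group-groupoid actions of $G$ on groups and the category $\mathsf{LXMod}/(A,B,\alpha)$ of lifting crossed modules of $(A,B,\alpha)$ are equivalent.
   Context: Groups are written additively but need not be commutative. For a groupoid $G$ (the set of morphisms is also denoted $G$), $d_0,d_1\colon G\to\operatorname{Ob}(G)$ are source and target, $1_x$ is the identity at $x$, and $h\circ g$ is defined iff $d_0(h)=d_1(g)$. A group-groupoid is a groupoid $G$ with groupoid morphisms $G\times G\to G$, $(g,h)\mapsto g+h$, and $G\to G$, $g\mapsto -g$, yielding a group structure internal to the category of groupoids; thus $G$ and $\operatorname{Ob}(G)$ are groups, the structure maps are group morphisms, and $(b\circ a)+(d\circ c)=(b+d)\circ(a+c)$ whenever $b\circ a$, $d\circ c$ are defined. A crossed module $(A,B,\alpha)$ consists of groups $A,B$, a left action of $B$ on $A$ by group automorphisms, written $b\cdot a$, and a group morphism $\alpha\colon A\to B$ with $\alpha(b\cdot a)=b+\alpha(a)-b$ and $\alpha(a)\cdot a_1=a+a_1-a$. An action of the group-groupoid $G$ on a group $X$ via $\omega$ consists of a group morphism $\omega\colon X\to\operatorname{Ob}(G)$ and a function $(g,x)\mapsto g\bullet x\in X$, defined for $g\in G$, $x\in X$ with $d_0(g)=\omega(x)$, such that $\omega(g\bullet x)=d_1(g)$,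 $1_{\omega(x)}\bullet x=x$, $(h\circ g)\bullet x=h\bullet(g\bullet x)$ whenever $h\circ g$ and $g\bullet x$ are defined, and $(g\bullet x)+(g'\bullet x')=(g+g')\bullet(x+x')$ whenever both sides are defined. A morphism $(X,\omega)\to(X',\omega')$ of such actions is a group morphism $f\colon X\to X'$ with $\omega'f=\omega$ and $f(g\bullet x)=g\bullet f(x)$ whenever $g\bullet x$ is defined. These form the category $\mathsf{GpGpdAct}(G)$. A lifting $(\varphi,X,\omega)$ of a crossed module $(A,B,\alpha)$ consists of a group $X$ and group morphisms $\omega\colon X\to B$, $\varphi\colon A\to X$ such that $\omega\varphi=\alpha$ and $(A,X,\varphi)$ is a crossed module with the action $x\cdot a:=\omega(x)\cdot a$. A morphism $(\varphi,X,\omega)\to(\varphi',X',\omega')$ of liftings is a group morphism $f\colon X\to X'$ with $f\varphi=\varphi'$ and $\omega'f=\omega$. Liftings of $(A,B,\alpha)$ and these morphisms form the category $\mathsf{LXMod}/(A,B,\alpha)$. *)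

theory Defs
  imports "HOL-Algebra.Coset" "HOL-Algebra.Bij"
begin

section \<open>Categories and equivalence of categories\<close>

text \<open>\<open>cmp C h g\<close> is ``\<open>h\<close> after \<open>g\<close>'', meaningful only if \<open>d0 C h = d1 C g\<close>.\<close>

record ('o, 'm) category =
  Ob :: "'o set"
  Arr :: "'m set"
  d0 :: "'m \<Rightarrow> 'o"
  d1 :: "'m \<Rightarrow> 'o"
  idn :: "'o \<Rightarrow> 'm"
  cmp :: "'m \<Rightarrow> 'm \<Rightarrow> 'm"

locale category =
  fixes C :: "('o, 'm, 'z) category_scheme" (structure)
  assumes d0_closed: "g \<in> Arr C \<Longrightarrow> d0 C g \<in> Ob C"
    and d1_closed: "g \<in> Arr C \<Longrightarrow> d1 C g \<in> Ob C"
    and idn_closed: "x \<in> Ob C \<Longrightarrow> idn C x \<in> Arr C"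
    and d0_idn: "x \<in> Ob C \<Longrightarrow> d0 C (idn C x) = x"
    and d1_idn: "x \<in> Ob C \<Longrightarrow> d1 C (idn C x) = x"
    and cmp_closed: "\<lbrakk>h \<in> Arr C; g \<in> Arr C; d0 C h = d1 C g\<rbrakk> \<Longrightarrow> cmp C h g \<in> Arr C"
    and d0_cmp: "\<lbrakk>h \<in> Arr C; g \<in> Arr C; d0 C h = d1 C g\<rbrakk> \<Longrightarrow> d0 C (cmp C h g) = d0 C g"
    and d1_cmp: "\<lbrakk>h \<in> Arr C; g \<in> Arr C; d0 C h = d1 C g\<rbrakk> \<Longrightarrow> d1 C (cmp C h g) = d1 C h"
    and cmp_idn_right: "g \<in> Arr C \<Longrightarrow> cmp C g (idn C (d0 C g)) = g"
    and cmp_idn_left: "g \<in> Arr C \<Longrightarrow> cmp C (idn C (d1 C g)) g = g"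
    and cmp_assoc: "\<lbrakk>k \<in> Arr C; h \<in> Arr C; g \<in> Arr C; d0 C k = d1 C h; d0 C h = d1 C g\<rbrakk>
      \<Longrightarrow> cmp C (cmp C k h) g = cmp C k (cmp C h g)"

definition iso_arrow :: "('o, 'm, 'z) category_scheme \<Rightarrow> 'm \<Rightarrow> bool" where
  "iso_arrow C g \<longleftrightarrow> g \<in> Arr C \<and>
    (\<exists>h \<in> Arr C. d0 C h = d1 C g \<and> d1 C h = d0 C g \<and>
      cmp C h g = idn C (d0 C g) \<and> cmp C g h = idn C (d1 C g))"

text \<open>A functor is given by its object part and its arrow part.\<close>

locale cat_functor = dom: category C + cod: category D
  for C :: "('o, 'm, 'z) category_scheme" and D :: "('p, 'n, 'w) category_scheme" +
  fixes Fo :: "'o \<Rightarrow> 'p" and Fa :: "'m \<Rightarrow> 'n"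
  assumes Fo_closed: "x \<in> Ob C \<Longrightarrow> Fo x \<in> Ob D"
    and Fa_closed: "g \<in> Arr C \<Longrightarrow> Fa g \<in> Arr D"
    and Fa_d0: "g \<in> Arr C \<Longrightarrow> d0 D (Fa g) = Fo (d0 C g)"
    and Fa_d1: "g \<in> Arr C \<Longrightarrow> d1 D (Fa g) = Fo (d1 C g)"
    and Fa_idn: "x \<in> Ob C \<Longrightarrow> Fa (idn C x) = idn D (Fo x)"
    and Fa_cmp: "\<lbrakk>h \<in> Arr C; g \<in> Arr C; d0 C h = d1 C g\<rbrakk>
      \<Longrightarrow> Fa (cmp C h g) = cmp D (Fa h) (Fa g)"

locale natural_isomorphism = F: cat_functor C D Fo Fa + F': cat_functor C D Fo' Fa'
  for C :: "('o, 'm, 'z) category_scheme" and D :: "('p, 'n, 'w) category_scheme"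
    and Fo Fa Fo' Fa' +
  fixes \<tau> :: "'o \<Rightarrow> 'n"
  assumes component_iso: "x \<in> Ob C \<Longrightarrow> iso_arrow D (\<tau> x)"
    and component_d0: "x \<in> Ob C \<Longrightarrow> d0 D (\<tau> x) = Fo x"
    and component_d1: "x \<in> Ob C \<Longrightarrow> d1 D (\<tau> x) = Fo' x"
    and naturality: "g \<in> Arr C
      \<Longrightarrow> cmp D (\<tau> (d1 C g)) (Fa g) = cmp D (Fa' g) (\<tau> (d0 C g))"

definition equivalent_categories ::
  "('o, 'm, 'z) category_scheme \<Rightarrow> ('p, 'n, 'w) category_scheme \<Rightarrow> bool" where
  "equivalent_categories C D \<longleftrightarrow>
    (\<exists>Fo Fa Ho Ha \<eta> \<epsilon>.
      cat_functor C D Fo Fa \<and> cat_functor D C Ho Ha \<and>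
      natural_isomorphism C C id id (Ho \<circ> Fo) (Ha \<circ> Fa) \<eta> \<and>
      natural_isomorphism D D (Fo \<circ> Ho) (Fa \<circ> Ha) id id \<epsilon>)"

definition product_category ::
  "('o, 'm, 'z) category_scheme \<Rightarrow> ('p, 'n, 'w) category_scheme
    \<Rightarrow> ('o \<times> 'p, 'm \<times> 'n) category" where
  "product_category C D =
    \<lparr>Ob = Ob C \<times> Ob D,
     Arr = Arr C \<times> Arr D,
     d0 = (\<lambda>(g, h). (d0 C g, d0 D h)),
     d1 = (\<lambda>(g, h). (d1 C g, d1 D h)),
     idn = (\<lambda>(x, y). (idn C x, idn D y)),
     cmp = (\<lambda>(g', h') (g, h). (cmp C g' g, cmp D h' h))\<rparr>"

definition terminal_category :: "(unit, unit) category" where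
  "terminal_category =
    \<lparr>Ob = UNIV, Arr = UNIV, d0 = id, d1 = id, idn = id, cmp = (\<lambda>_ _. ())\<rparr>"

text \<open>The category with objects \<open>S\<close> whose morphisms from \<open>X\<close> to \<open>Y\<close> are certain functions from the
  underlying set \<open>U X\<close> to \<open>U Y\<close>. Such a function is represented by a total HOL function that is
  \<^const>\<open>extensional\<close> on \<open>U X\<close>; an arrow also records its source and target.\<close>

definition concrete_category ::
  "'s set \<Rightarrow> ('s \<Rightarrow> 'x set) \<Rightarrow> ('s \<Rightarrow> 's \<Rightarrow> ('x \<Rightarrow> 'x) set)
    \<Rightarrow> ('s, 's \<times> ('x \<Rightarrow> 'x) \<times> 's) category" where
  "concrete_category S U H =
    \<lparr>Ob = S,
     Arr = {(X, f, Y). X \<in> S \<and> Y \<in> S \<and> f \<in> H X Y \<inter> extensional (U X)},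
     d0 = (\<lambda>(X, f, Y). X),
     d1 = (\<lambda>(X, f, Y). Y),
     idn = (\<lambda>X. (X, \<lambda>x\<in>U X. x, X)),
     cmp = (\<lambda>(X', g, Z) (X, f, Y). (X, compose (U X) g f, Z))\<rparr>"


section \<open>Groupoids and group-groupoids\<close>

locale groupoid = category +
  assumes all_iso: "g \<in> Arr C \<Longrightarrow> iso_arrow C g"

text \<open>The additive notation \<open>+\<close>, \<open>-\<close>, \<open>0\<close> customary for these (not necessarily commutative) groups
  is rendered by \<open>\<otimes>\<close>, \<open>inv\<close>, \<open>\<one>\<close> of HOL-Algebra. A group structure internal to groupoids
  is one on the objects and one on the arrows, with functorial operations.\<close>

record ('o, 'm) group_groupoid = "('o, 'm) category" +
  ObGp :: "'o monoid"
  ArrGp :: "'m monoid"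

locale group_groupoid = groupoid G
  for G :: "('o, 'm, 'z) group_groupoid_scheme" (structure) +
  assumes carrier_ObGp: "carrier (ObGp G) = Ob G"
    and carrier_ArrGp: "carrier (ArrGp G) = Arr G"
    and group_ObGp: "group (ObGp G)"
    and group_ArrGp: "group (ArrGp G)"
    and add_functor: "cat_functor (product_category G G) G
      (\<lambda>(x, y). x \<otimes>\<^bsub>ObGp G\<^esub> y) (\<lambda>(g, h). g \<otimes>\<^bsub>ArrGp G\<^esub> h)"
    and neg_functor: "cat_functor G G (m_inv (ObGp G)) (m_inv (ArrGp G))"
    and zero_functor: "cat_functor terminal_category G
      (\<lambda>_. \<one>\<^bsub>ObGp G\<^esub>) (\<lambda>_. \<one>\<^bsub>ArrGp G\<^esub>)"


section \<open>Crossed modules and their liftings\<close>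

text \<open>\<open>(A, B, \<alpha>)\<close> together with the action, a homomorphism from \<open>B\<close> to the automorphism group of
  \<open>A\<close>.\<close>

record ('a, 'b) crossed_module =
  XA :: "'a monoid"
  XB :: "'b monoid"
  Xact :: "'b \<Rightarrow> 'a \<Rightarrow> 'a"
  Xmap :: "'a \<Rightarrow> 'b"

locale crossed_module =
  fixes M :: "('a, 'b, 'z) crossed_module_scheme" (structure)
  assumes group_XA: "group (XA M)"
    and group_XB: "group (XB M)"
    and Xact_hom: "Xact M \<in> hom (XB M) (AutoGroup (XA M))"
    and Xmap_hom: "Xmap M \<in> hom (XA M) (XB M)"
    and equivariance: "\<lbrakk>b \<in> carrier (XB M); a \<in> carrier (XA M)\<rbrakk> \<Longrightarrow>
      Xmap M (Xact M b a) = b \<otimes>\<^bsub>XB M\<^esub> Xmap M a \<otimes>\<^bsub>XB M\<^esub> inv\<^bsub>XB M\<^esub> b"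
    and peiffer: "\<lbrakk>a \<in> carrier (XA M); a\<^sub>1 \<in> carrier (XA M)\<rbrakk> \<Longrightarrow>
      Xact M (Xmap M a) a\<^sub>1 = a \<otimes>\<^bsub>XA M\<^esub> a\<^sub>1 \<otimes>\<^bsub>XA M\<^esub> inv\<^bsub>XA M\<^esub> a"

definition crossed_module_of ::
  "('o, 'm, 'z) group_groupoid_scheme \<Rightarrow> ('m, 'o) crossed_module" where
  "crossed_module_of G =
    (let K = kernel (ArrGp G) (ObGp G) (d0 G)
     in \<lparr>XA = (ArrGp G)\<lparr>carrier := K\<rparr>,
         XB = ObGp G,
         Xact = (\<lambda>b. \<lambda>a\<in>K. idn G b \<otimes>\<^bsub>ArrGp G\<^esub> a \<otimes>\<^bsub>ArrGp G\<^esub> inv\<^bsub>ArrGp G\<^esub> (idn G b)),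
         Xmap = restrict (d1 G) K\<rparr>)"

text \<open>In the objects of the two categories below, the structure maps are \<^const>\<open>extensional\<close>, so
  that equality of HOL functions is equality of functions on the intended domain. The values of the
  operation of a HOL-Algebra group outside its carrier remain arbitrary; objects that differ only in
  them are isomorphic via the identity.\<close>

record ('a, 'b, 'x) lifting =
  Lphi :: "'a \<Rightarrow> 'x"
  LX :: "'x monoid"
  Lom :: "'x \<Rightarrow> 'b"

definition liftings :: "('a, 'b, 'z) crossed_module_scheme \<Rightarrow> ('a, 'b, 'x) lifting set" where
  "liftings M = {L.
    group (LX L) \<and>
    Lom L \<in> hom (LX L) (XB M) \<inter> extensional (carrier (LX L)) \<and>
    Lphi L \<in> hom (XA M) (LX L) \<inter> extensional (carrier (XA M)) \<and>
    (\<forall>a \<in> carrier (XA M). Lom L (Lphi L a) = Xmap M a) \<and>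
    crossed_module
      \<lparr>XA = XA M, XB = LX L, Xact = (\<lambda>x. Xact M (Lom L x)), Xmap = Lphi L\<rparr>}"

definition lifting_hom ::
  "('a, 'b, 'z) crossed_module_scheme \<Rightarrow> ('a, 'b, 'x) lifting \<Rightarrow> ('a, 'b, 'x) lifting
    \<Rightarrow> ('x \<Rightarrow> 'x) set" where
  "lifting_hom M L L' = {f \<in> hom (LX L) (LX L').
    (\<forall>a \<in> carrier (XA M). f (Lphi L a) = Lphi L' a) \<and>
    (\<forall>x \<in> carrier (LX L). Lom L' (f x) = Lom L x)}"

definition LXMod ::
  "('a, 'b, 'z) crossed_module_scheme
    \<Rightarrow> (('a, 'b, 'x) lifting, ('a, 'b, 'x) lifting \<times> ('x \<Rightarrow> 'x) \<times> ('a, 'b, 'x) lifting) category"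
  where "LXMod M = concrete_category (liftings M) (\<lambda>L. carrier (LX L)) (lifting_hom M)"


section \<open>Actions of group-groupoids on groups\<close>

record ('o, 'm, 'x) gpgpd_action =
  GX :: "'x monoid"
  Gom :: "'x \<Rightarrow> 'o"
  Gact :: "'m \<Rightarrow> 'x \<Rightarrow> 'x"

definition act_domain ::
  "('o, 'm, 'z) group_groupoid_scheme \<Rightarrow> ('o, 'm, 'x) gpgpd_action \<Rightarrow> ('m \<times> 'x) set" where
  "act_domain G P = {(g, x). g \<in> Arr G \<and> x \<in> carrier (GX P) \<and> d0 G g = Gom P x}"

definition gpgpd_actions ::
  "('o, 'm, 'z) group_groupoid_scheme \<Rightarrow> ('o, 'm, 'x) gpgpd_action set" where
  "gpgpd_actions G = {P.
    group (GX P) \<and>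
    Gom P \<in> hom (GX P) (ObGp G) \<inter> extensional (carrier (GX P)) \<and>
    case_prod (Gact P) \<in> act_domain G P \<rightarrow>\<^sub>E carrier (GX P) \<and>
    (\<forall>(g, x) \<in> act_domain G P. Gom P (Gact P g x) = d1 G g) \<and>
    (\<forall>x \<in> carrier (GX P). Gact P (idn G (Gom P x)) x = x) \<and>
    (\<forall>h \<in> Arr G. \<forall>(g, x) \<in> act_domain G P. d0 G h = d1 G g \<longrightarrow>
      Gact P (cmp G h g) x = Gact P h (Gact P g x)) \<and>
    (\<forall>(g, x) \<in> act_domain G P. \<forall>(g', x') \<in> act_domain G P.
      Gact P g x \<otimes>\<^bsub>GX P\<^esub> Gact P g' x'
        = Gact P (g \<otimes>\<^bsub>ArrGp G\<^esub> g') (x \<otimes>\<^bsub>GX P\<^esub> x'))}"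

definition gpgpd_action_hom ::
  "('o, 'm, 'z) group_groupoid_scheme
    \<Rightarrow> ('o, 'm, 'x) gpgpd_action \<Rightarrow> ('o, 'm, 'x) gpgpd_action \<Rightarrow> ('x \<Rightarrow> 'x) set" where
  "gpgpd_action_hom G P P' = {f \<in> hom (GX P) (GX P').
    (\<forall>x \<in> carrier (GX P). Gom P' (f x) = Gom P x) \<and>
    (\<forall>(g, x) \<in> act_domain G P. f (Gact P g x) = Gact P' g (f x))}"

definition GpGpdAct ::
  "('o, 'm, 'z) group_groupoid_scheme
    \<Rightarrow> (('o, 'm, 'x) gpgpd_action,
        ('o, 'm, 'x) gpgpd_action \<times> ('x \<Rightarrow> 'x) \<times> ('o, 'm, 'x) gpgpd_action) category"
  where "GpGpdAct G =
    concrete_category (gpgpd_actions G) (\<lambda>P. carrier (GX P)) (gpgpd_action_hom G)"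

end

theory Submission
  imports Defs
begin

text \<open>The two categories are even isomorphic. An action yields the lifting \<open>\<phi> a = a \<bullet> 0\<close>; conversely,
  \<open>g = (g - 1\<^bsub>\<omega> x\<^esub>) + 1\<^bsub>\<omega> x\<^esub>\<close> forces \<open>g \<bullet> x = \<phi> (g - 1\<^bsub>\<omega> x\<^esub>) + x\<close>, and this formula defines an
  action for every lifting. Functoriality in \<open>g\<close> comes from \<open>h \<circ> g = h - 1\<^bsub>d\<^sub>0 h\<^esub> + g\<close>, additivity
  from the equivariance of \<open>\<phi>\<close>. On morphisms both functors keep the underlying function.\<close>

section \<open>Concrete categories\<close>

text \<open>Extensionality of the arrows turns the unit laws of \<open>compose\<close> into
  equations of HOL functions; \<open>maps\<close> keeps intermediate values in the underlying set,
  on which associativity rests.\<close>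

lemma category_concrete_category:
  assumes maps: "\<And>X Y f. \<lbrakk>X \<in> S; Y \<in> S; f \<in> H X Y\<rbrakk> \<Longrightarrow> f \<in> U X \<rightarrow> U Y"
    and ident: "\<And>X. X \<in> S \<Longrightarrow> (\<lambda>x\<in>U X. x) \<in> H X X"
    and comp: "\<And>X Y Z f g. \<lbrakk>X \<in> S; Y \<in> S; Z \<in> S; f \<in> H X Y; g \<in> H Y Z\<rbrakk>
      \<Longrightarrow> compose (U X) g f \<in> H X Z"
  shows "category (concrete_category S U H)"
  by unfold_locales
    (auto simp: concrete_category_def ident intro: comp compose_assoc[OF maps, symmetric]
       Id_compose[OF maps] compose_Id[OF maps])

lemma (in category) iso_arrow_idn:
  assumes "x \<in> Ob C"
  shows "iso_arrow C (idn C x)"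
  unfolding iso_arrow_def
  using assms cmp_idn_left[OF idn_closed[OF assms]]
  by (auto simp: idn_closed d0_idn d1_idn intro!: bexI[of _ "idn C x"])

lemma (in category) cat_functor_id: "cat_functor C C id id"
  by unfold_locales auto

text \<open>Agreement with the identity is asked only on objects and arrows of \<open>C\<close>,
  because round-trip composites are arbitrary elsewhere. Keeping both functors general serves the
  unit and the counit alike.\<close>

lemma (in category) natural_isomorphism_idn:
  assumes F: "cat_functor C C Fo Fa" and F': "cat_functor C C Fo' Fa'"
    and ob: "\<And>x. x \<in> Ob C \<Longrightarrow> Fo x = x" "\<And>x. x \<in> Ob C \<Longrightarrow> Fo' x = x"
    and arr: "\<And>g. g \<in> Arr C \<Longrightarrow> Fa g = g" "\<And>g. g \<in> Arr C \<Longrightarrow> Fa' g = g"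
  shows "natural_isomorphism C C Fo Fa Fo' Fa' (idn C)"
  by (intro natural_isomorphism.intro natural_isomorphism_axioms.intro F F')
    (simp_all add: iso_arrow_idn ob arr d0_idn d1_idn cmp_idn_left cmp_idn_right)

text \<open>Since \<open>Fo\<close> keeps underlying sets, identities and composites on the two
  sides are the same restricted functions, so the underlying function of an arrow can be left
  untouched.\<close>

lemma cat_functor_concrete_category:
  assumes C: "category (concrete_category S U H)" and D: "category (concrete_category T V K)"
    and Fo: "\<And>X. X \<in> S \<Longrightarrow> Fo X \<in> T"
    and U: "\<And>X. X \<in> S \<Longrightarrow> V (Fo X) = U X"
    and H: "\<And>X Y. \<lbrakk>X \<in> S; Y \<in> S\<rbrakk> \<Longrightarrow> H X Y \<subseteq> K (Fo X) (Fo Y)"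
  shows "cat_functor (concrete_category S U H) (concrete_category T V K)
    Fo (\<lambda>(X, f, Y). (Fo X, f, Fo Y))"
  by (intro cat_functor.intro cat_functor_axioms.intro C D)
    (use H in \<open>auto simp: concrete_category_def Fo U\<close>)

lemma cat_functor_comp:
  assumes "cat_functor C D Fo Fa" "cat_functor D E Ho Ha"
  shows "cat_functor C E (Ho \<circ> Fo) (Ha \<circ> Fa)"
proof -
  interpret F: cat_functor C D Fo Fa by fact
  interpret H: cat_functor D E Ho Ha by fact
  show ?thesis
    by unfold_locales
      (simp_all add: F.Fo_closed F.Fa_closed F.Fa_d0 F.Fa_d1 F.Fa_idn F.Fa_cmp
        H.Fo_closed H.Fa_closed H.Fa_d0 H.Fa_d1 H.Fa_idn H.Fa_cmp)
qed

text \<open>A bijection on objects that keeps underlying sets and hom-sets is an isomorphism of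
  categories, so unit and counit can be taken to be identities.\<close>

lemma equivalent_concrete_categories:
  assumes C: "category (concrete_category S U H)" and D: "category (concrete_category T V K)"
    and Fo: "\<And>X. X \<in> S \<Longrightarrow> Fo X \<in> T" and Ho: "\<And>Y. Y \<in> T \<Longrightarrow> Ho Y \<in> S"
    and HF: "\<And>X. X \<in> S \<Longrightarrow> Ho (Fo X) = X" and FH: "\<And>Y. Y \<in> T \<Longrightarrow> Fo (Ho Y) = Y"
    and U: "\<And>X. X \<in> S \<Longrightarrow> V (Fo X) = U X"
    and H: "\<And>X Y. \<lbrakk>X \<in> S; Y \<in> S\<rbrakk> \<Longrightarrow> K (Fo X) (Fo Y) = H X Y"
  shows "equivalent_categories (concrete_category S U H) (concrete_category T V K)"
proof -
  let ?C = "concrete_category S U H" and ?D = "concrete_category T V K"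
  let ?Fa = "\<lambda>(X, f :: 'b \<Rightarrow> 'b, Y). (Fo X, f, Fo Y)"
    and ?Ha = "\<lambda>(X, f :: 'b \<Rightarrow> 'b, Y). (Ho X, f, Ho Y)"
  interpret C: category ?C by (rule C)
  interpret D: category ?D by (rule D)
  have F: "cat_functor ?C ?D Fo ?Fa"
    using H by (intro cat_functor_concrete_category C D Fo U) auto
  \<comment> \<open>The conditions on \<open>Ho\<close> are those on \<open>Fo\<close> taken at
    objects \<open>Ho Y\<close> and rewritten with \<open>FH\<close>; this direction uses the
    inclusion of \<open>K\<close> in \<open>H\<close>.\<close>
  have G: "cat_functor ?D ?C Ho ?Ha"
    using H U FH Ho by (intro cat_functor_concrete_category C D Ho) (metis order_refl)+
  have "natural_isomorphism ?C ?C id id (Ho \<circ> Fo) (?Ha \<circ> ?Fa) (idn ?C)"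
    by (rule C.natural_isomorphism_idn[OF C.cat_functor_id cat_functor_comp[OF F G]])
      (auto simp: concrete_category_def HF)
  moreover have "natural_isomorphism ?D ?D (Fo \<circ> Ho) (?Fa \<circ> ?Ha) id id (idn ?D)"
    by (rule D.natural_isomorphism_idn[OF cat_functor_comp[OF G F] D.cat_functor_id])
      (auto simp: concrete_category_def FH)
  ultimately show ?thesis
    unfolding equivalent_categories_def using F G by blast
qed

section \<open>Actions and liftings form categories\<close>

lemma restrict_id_hom: "(\<lambda>x\<in>carrier X. x) \<in> hom X X" if "group X"
proof -
  interpret group X by fact
  show ?thesis by (simp add: hom_def Pi_def)
qed

lemma compose_hom:
  assumes "group X" "f \<in> hom X Y" "g \<in> hom Y Z"
  shows "compose (carrier X) g f \<in> hom X Z"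
proof -
  interpret group X by fact
  from assms(2,3) show ?thesis by (auto simp: hom_def compose_def Pi_def)
qed

text \<open>The clauses are cited by position: (4) extensionality, (5) closure, (6) target, (7)
  identity law, (9) additivity.\<close>

lemma gpgpd_actionsD:
  assumes "P \<in> gpgpd_actions G"
  shows "group (GX P)" "Gom P \<in> hom (GX P) (ObGp G)" "Gom P \<in> extensional (carrier (GX P))"
    and "case_prod (Gact P) \<in> act_domain G P \<rightarrow>\<^sub>E carrier (GX P)"
    and "(g, x) \<in> act_domain G P \<Longrightarrow> Gact P g x \<in> carrier (GX P)"
    and "(g, x) \<in> act_domain G P \<Longrightarrow> Gom P (Gact P g x) = d1 G g"
    and "x \<in> carrier (GX P) \<Longrightarrow> Gact P (idn G (Gom P x)) x = x"
    and "\<lbrakk>h \<in> Arr G; (g, x) \<in> act_domain G P; d0 G h = d1 G g\<rbrakk>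
      \<Longrightarrow> Gact P (cmp G h g) x = Gact P h (Gact P g x)"
    and "\<lbrakk>(g, x) \<in> act_domain G P; (g', x') \<in> act_domain G P\<rbrakk>
      \<Longrightarrow> Gact P g x \<otimes>\<^bsub>GX P\<^esub> Gact P g' x'
        = Gact P (g \<otimes>\<^bsub>ArrGp G\<^esub> g') (x \<otimes>\<^bsub>GX P\<^esub> x')"
  using assms unfolding gpgpd_actions_def by (auto dest: PiE_mem)

lemma liftingsD:
  assumes "L \<in> liftings M"
  shows "group (LX L)" "Lom L \<in> hom (LX L) (XB M)" "Lom L \<in> extensional (carrier (LX L))"
    and "Lphi L \<in> hom (XA M) (LX L)" "Lphi L \<in> extensional (carrier (XA M))"
    and "a \<in> carrier (XA M) \<Longrightarrow> Lom L (Lphi L a) = Xmap M a"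
    and "crossed_module
      \<lparr>XA = XA M, XB = LX L, Xact = (\<lambda>x. Xact M (Lom L x)), Xmap = Lphi L\<rparr>"
  using assms unfolding liftings_def by auto

lemma category_GpGpdAct: "category (GpGpdAct G)"
  unfolding GpGpdAct_def
proof (rule category_concrete_category)
  show "f \<in> carrier (GX P) \<rightarrow> carrier (GX Q)" if "f \<in> gpgpd_action_hom G P Q" for P Q f
    using that by (auto simp: gpgpd_action_hom_def hom_def)
next
  fix P assume P: "P \<in> gpgpd_actions G"
  then show "(\<lambda>x\<in>carrier (GX P). x) \<in> gpgpd_action_hom G P P"
    by (auto simp: gpgpd_action_hom_def restrict_id_hom gpgpd_actionsD act_domain_def)
next
  fix P Q R f g
  assume P: "P \<in> gpgpd_actions G" and f: "f \<in> gpgpd_action_hom G P Q"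
    and g: "g \<in> gpgpd_action_hom G Q R"
  have fx: "f x \<in> carrier (GX Q)" if "x \<in> carrier (GX P)" for x
    using f that by (auto simp: gpgpd_action_hom_def hom_def)
  \<comment> \<open>Compatibility with \<omega> carries the domain of one action into that of the
    next, so the equivariance of \<open>g\<close> can be used at \<open>f x\<close>.\<close>
  have dom: "(k, f x) \<in> act_domain G Q" if "(k, x) \<in> act_domain G P" for k x
    using f that fx by (auto simp: gpgpd_action_hom_def act_domain_def)
  \<comment> \<open>Needed to evaluate \<open>compose\<close>, which is \<open>undefined\<close> off
    the carrier.\<close>
  have "Gact P k x \<in> carrier (GX P)" "x \<in> carrier (GX P)" if "(k, x) \<in> act_domain G P" for k x
    using gpgpd_actionsD(5)[OF P that] that by (auto simp: act_domain_def)
  with f g fx dom show "compose (carrier (GX P)) g f \<in> gpgpd_action_hom G P R"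
    by (fastforce simp: gpgpd_action_hom_def compose_eq intro: compose_hom gpgpd_actionsD(1)[OF P])
qed

lemma category_LXMod: "category (LXMod M)"
  unfolding LXMod_def
proof (rule category_concrete_category)
  show "f \<in> carrier (LX L) \<rightarrow> carrier (LX L')" if "f \<in> lifting_hom M L L'" for L L' f
    using that by (auto simp: lifting_hom_def hom_def)
next
  fix L assume L: "L \<in> liftings M"
  then have "Lphi L a \<in> carrier (LX L)" if "a \<in> carrier (XA M)" for a
    using liftingsD(4) that by (auto simp: hom_def)
  with L show "(\<lambda>x\<in>carrier (LX L). x) \<in> lifting_hom M L L"
    by (auto simp: lifting_hom_def restrict_id_hom liftingsD)
next
  fix L L' L'' f g
  assume L: "L \<in> liftings M" and f: "f \<in> lifting_hom M L L'" and g: "g \<in> lifting_hom M L' L''"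
  have "f x \<in> carrier (LX L')" if "x \<in> carrier (LX L)" for x
    using f that by (auto simp: lifting_hom_def hom_def)
  moreover have "Lphi L a \<in> carrier (LX L)" if "a \<in> carrier (XA M)" for a
    using liftingsD(4)[OF L] that by (auto simp: hom_def)
  ultimately show "compose (carrier (LX L)) g f \<in> lifting_hom M L L''"
    using f g by (auto simp: lifting_hom_def compose_eq intro: compose_hom liftingsD(1)[OF L])
qed

section \<open>The crossed module of a group-groupoid\<close>

text \<open>After right-association by \<open>m_assoc\<close>, an inverse pair followed by a further
  factor is no longer a subterm; these rules cancel it.\<close>

lemma (in group) inv_mult_cancel:
  assumes "x \<in> carrier G" "y \<in> carrier G"
  shows "inv x \<otimes> (x \<otimes> y) = y" "x \<otimes> (inv x \<otimes> y) = y"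
  using assms by (simp_all flip: m_assoc)

context group_groupoid
begin

text \<open>The \<open>rewrites\<close> clause puts the group laws in terms of \<open>Ob G\<close>,
  the set in which the groupoid axioms are phrased.\<close>

sublocale Ob: group "ObGp G" rewrites "carrier (ObGp G) = Ob G"
  by (rule group_ObGp carrier_ObGp)+

sublocale Arr: group "ArrGp G" rewrites "carrier (ArrGp G) = Arr G"
  by (rule group_ArrGp carrier_ArrGp)+

text \<open>This and the next three laws are functoriality of addition on
  \<open>product_category G G\<close>, read off at a pair.\<close>

lemma d0_mult: "\<lbrakk>g \<in> Arr G; h \<in> Arr G\<rbrakk> \<Longrightarrow> d0 G (g \<otimes>\<^bsub>ArrGp G\<^esub> h) = d0 G g \<otimes>\<^bsub>ObGp G\<^esub> d0 G h"
  using cat_functor.Fa_d0[OF add_functor, of "(g, h)"] by (simp add: product_category_def)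

lemma d1_mult: "\<lbrakk>g \<in> Arr G; h \<in> Arr G\<rbrakk> \<Longrightarrow> d1 G (g \<otimes>\<^bsub>ArrGp G\<^esub> h) = d1 G g \<otimes>\<^bsub>ObGp G\<^esub> d1 G h"
  using cat_functor.Fa_d1[OF add_functor, of "(g, h)"] by (simp add: product_category_def)

lemma idn_mult: "\<lbrakk>x \<in> Ob G; y \<in> Ob G\<rbrakk> \<Longrightarrow> idn G (x \<otimes>\<^bsub>ObGp G\<^esub> y) = idn G x \<otimes>\<^bsub>ArrGp G\<^esub> idn G y"
  using cat_functor.Fa_idn[OF add_functor, of "(x, y)"] by (simp add: product_category_def)

lemma interchange:
  assumes "b \<in> Arr G" "a \<in> Arr G" "d \<in> Arr G" "c \<in> Arr G" "d0 G b = d1 G a" "d0 G d = d1 G c"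
  shows "cmp G b a \<otimes>\<^bsub>ArrGp G\<^esub> cmp G d c
    = cmp G (b \<otimes>\<^bsub>ArrGp G\<^esub> d) (a \<otimes>\<^bsub>ArrGp G\<^esub> c)"
  using cat_functor.Fa_cmp[OF add_functor, of "(b, d)" "(a, c)"] assms
  by (simp add: product_category_def)

sublocale d0: group_hom "ArrGp G" "ObGp G" "d0 G"
  rewrites "carrier (ArrGp G) = Arr G" and "carrier (ObGp G) = Ob G"
  by (unfold_locales; simp add: hom_def carrier_ArrGp carrier_ObGp d0_closed d0_mult)+

sublocale d1: group_hom "ArrGp G" "ObGp G" "d1 G"
  rewrites "carrier (ArrGp G) = Arr G" and "carrier (ObGp G) = Ob G"
  by (unfold_locales; simp add: hom_def carrier_ArrGp carrier_ObGp d1_closed d1_mult)+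

sublocale idn: group_hom "ObGp G" "ArrGp G" "idn G"
  rewrites "carrier (ArrGp G) = Arr G" and "carrier (ObGp G) = Ob G"
  by (unfold_locales; simp add: hom_def carrier_ArrGp carrier_ObGp idn_closed idn_mult)+

text \<open>With \<open>e\<close> the identity at \<open>d1 G g\<close>, interchange is applied
  twice: first \<open>h - e\<close> is written as a composite
  \<open>(h - e) \<circ> (e - e)\<close>, then \<open>e \<circ> g\<close> is added to it and the
  identities cancel.\<close>

lemma cmp_eq_mult:
  assumes h: "h \<in> Arr G" and g: "g \<in> Arr G" and hg: "d0 G h = d1 G g"
  shows "cmp G h g = h \<otimes>\<^bsub>ArrGp G\<^esub> inv\<^bsub>ArrGp G\<^esub> (idn G (d1 G g)) \<otimes>\<^bsub>ArrGp G\<^esub> g"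
proof -
  let ?e = "idn G (d1 G g)" and ?i = "inv\<^bsub>ArrGp G\<^esub> (idn G (d1 G g))"
  have e: "?e \<in> Arr G" "?i \<in> Arr G" using g by simp_all
  have i: "?i = idn G (inv\<^bsub>ObGp G\<^esub> (d1 G g))" using g by simp
  have d: "d0 G ?e = d1 G g" "d1 G ?e = d1 G g" "d0 G ?i = inv\<^bsub>ObGp G\<^esub> (d1 G g)"
    "d1 G ?i = inv\<^bsub>ObGp G\<^esub> (d1 G g)"
    using g by (simp_all add: d0_idn d1_idn)
  \<comment> \<open>The negative of an identity arrow is an identity arrow, hence
    idempotent.\<close>
  have ii: "cmp G ?i ?i = ?i"
    using cmp_idn_left[OF e(2)] d i by simp
  have h_eq: "cmp G h ?e = h" using cmp_idn_right[OF h] hg by simp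
  \<comment> \<open>The zero arrow is kept in the form \<open>?e - ?e\<close>, so that adding
    \<open>g\<close> later leaves exactly \<open>g\<close> in the second factor.\<close>
  have "h \<otimes>\<^bsub>ArrGp G\<^esub> ?i = cmp G (h \<otimes>\<^bsub>ArrGp G\<^esub> ?i) (?e \<otimes>\<^bsub>ArrGp G\<^esub> ?i)"
    using interchange[OF h e(1) e(2) e(2)] d hg h_eq ii by simp
  then have "h \<otimes>\<^bsub>ArrGp G\<^esub> ?i \<otimes>\<^bsub>ArrGp G\<^esub> g
      = cmp G (h \<otimes>\<^bsub>ArrGp G\<^esub> ?i) (?e \<otimes>\<^bsub>ArrGp G\<^esub> ?i) \<otimes>\<^bsub>ArrGp G\<^esub> cmp G ?e g"
    using cmp_idn_left[OF g] by simp
  also have "\<dots> = cmp G (h \<otimes>\<^bsub>ArrGp G\<^esub> ?i \<otimes>\<^bsub>ArrGp G\<^esub> ?e) (?e \<otimes>\<^bsub>ArrGp G\<^esub> ?i \<otimes>\<^bsub>ArrGp G\<^esub> g)"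
    using h g e d hg by (intro interchange) (simp_all add: d0_mult d1_mult)
  also have "\<dots> = cmp G h g"
    using h g e by (simp add: Arr.m_assoc)
  finally show ?thesis by simp
qed

text \<open>Both \<open>k + a\<close> and \<open>a + k\<close> equal the composite \<open>a \<circ> k\<close>.\<close>

lemma kernels_commute:
  assumes k: "k \<in> Arr G" "d1 G k = \<one>\<^bsub>ObGp G\<^esub>" and a: "a \<in> Arr G" "d0 G a = \<one>\<^bsub>ObGp G\<^esub>"
  shows "k \<otimes>\<^bsub>ArrGp G\<^esub> a = a \<otimes>\<^bsub>ArrGp G\<^esub> k"
proof -
  let ?e = "\<one>\<^bsub>ArrGp G\<^esub>"
  have "cmp G ?e k = k" "cmp G a ?e = a"
    using cmp_idn_left[OF k(1)] cmp_idn_right[OF a(1)] k a by simp_all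
  then show ?thesis
    using interchange[of ?e k a ?e] interchange[of a ?e ?e k] k a by simp
qed

section \<open>The kernel of the source map and the action on it\<close>

definition ker_d0 where "ker_d0 = kernel (ArrGp G) (ObGp G) (d0 G)"

lemma mem_ker_d0: "a \<in> ker_d0 \<longleftrightarrow> a \<in> Arr G \<and> d0 G a = \<one>\<^bsub>ObGp G\<^esub>"
  by (simp add: ker_d0_def kernel_def carrier_ArrGp)

lemma subgroup_ker_d0: "subgroup ker_d0 (ArrGp G)"
  unfolding ker_d0_def by (rule d0.subgroup_kernel)

lemma crossed_module_of_simps:
  "XA (crossed_module_of G) = (ArrGp G)\<lparr>carrier := ker_d0\<rparr>"
  "XB (crossed_module_of G) = ObGp G"
  "Xact (crossed_module_of G) = (\<lambda>b. \<lambda>a\<in>ker_d0.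
     idn G b \<otimes>\<^bsub>ArrGp G\<^esub> a \<otimes>\<^bsub>ArrGp G\<^esub> inv\<^bsub>ArrGp G\<^esub> (idn G b))"
  "Xmap (crossed_module_of G) = restrict (d1 G) ker_d0"
  by (simp_all add: crossed_module_of_def ker_d0_def Let_def)

lemma conj_ker_d0:
  assumes "b \<in> Ob G" "a \<in> ker_d0"
  shows "idn G b \<otimes>\<^bsub>ArrGp G\<^esub> a \<otimes>\<^bsub>ArrGp G\<^esub> inv\<^bsub>ArrGp G\<^esub> (idn G b) \<in> ker_d0"
  using assms by (simp add: mem_ker_d0 d0_mult d0_idn del: idn.hom_inv)

text \<open>This is the kernel summand in the splitting of \<open>g\<close> as a kernel element plus
  an identity arrow. The separate \<open>b\<close> can be instantiated with
  \<omega>\<open>(x)\<close> or with \<open>d0 G g\<close>.\<close>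

lemma minus_idn_ker_d0:
  assumes "g \<in> Arr G" "d0 G g = b"
  shows "g \<otimes>\<^bsub>ArrGp G\<^esub> inv\<^bsub>ArrGp G\<^esub> (idn G b) \<in> ker_d0"
  using assms by (auto simp: mem_ker_d0 d0_idn simp del: idn.hom_inv)

text \<open>An equation of functions, off the kernel too, because the product in
  \<open>AutoGroup\<close> is \<open>compose\<close> on the carrier.\<close>

lemma Xact_mult:
  assumes b: "b \<in> Ob G" and c: "c \<in> Ob G"
  shows "Xact (crossed_module_of G) (b \<otimes>\<^bsub>ObGp G\<^esub> c)
    = compose ker_d0 (Xact (crossed_module_of G) b) (Xact (crossed_module_of G) c)"
proof
  fix a
  show "Xact (crossed_module_of G) (b \<otimes>\<^bsub>ObGp G\<^esub> c) a
    = compose ker_d0 (Xact (crossed_module_of G) b) (Xact (crossed_module_of G) c) a"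
  proof (cases "a \<in> ker_d0")
    case True
    then show ?thesis using b c conj_ker_d0
      by (simp add: crossed_module_of_simps compose_def mem_ker_d0 Arr.inv_mult_group Arr.m_assoc
          del: idn.hom_inv)
  qed (simp add: crossed_module_of_simps compose_def)
qed

lemma Xact_one: "Xact (crossed_module_of G) \<one>\<^bsub>ObGp G\<^esub> = (\<lambda>a\<in>ker_d0. a)"
  by (auto simp: crossed_module_of_simps mem_ker_d0)

lemma Xact_Auto:
  assumes b: "b \<in> Ob G"
  shows "Xact (crossed_module_of G) b \<in> auto ((ArrGp G)\<lparr>carrier := ker_d0\<rparr>)"
proof -
  let ?t = "Xact (crossed_module_of G)"
  have closed: "?t c a \<in> ker_d0" if "c \<in> Ob G" "a \<in> ker_d0" for c a
    using conj_ker_d0 that by (simp add: crossed_module_of_simps)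
  have inv: "?t c (?t c' a) = a"
    if "c \<in> Ob G" "c' \<in> Ob G" "c \<otimes>\<^bsub>ObGp G\<^esub> c' = \<one>\<^bsub>ObGp G\<^esub>" "a \<in> ker_d0" for c c' a
    using Xact_mult[OF that(1,2)] Xact_one that by (metis compose_eq restrict_apply')
  \<comment> \<open>The action of \<open>- b\<close> is a two-sided inverse, by
    \<open>Xact_mult\<close> and \<open>Xact_one\<close>.\<close>
  have "bij_betw (?t b) ker_d0 ker_d0"
    by (rule bij_betwI[where g = "?t (inv\<^bsub>ObGp G\<^esub> b)"]) (use b in \<open>auto simp: closed inv\<close>)
  moreover have "?t b (a \<otimes>\<^bsub>ArrGp G\<^esub> a') = ?t b a \<otimes>\<^bsub>ArrGp G\<^esub> ?t b a'"
    if "a \<in> ker_d0" "a' \<in> ker_d0" for a a'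
  proof -
    have "a \<otimes>\<^bsub>ArrGp G\<^esub> a' \<in> ker_d0" using that subgroup.m_closed[OF subgroup_ker_d0] by blast
    \<comment> \<open>A cancelling pair inserted between \<open>a\<close> and \<open>a'\<close>
      splits the conjugate of the sum.\<close>
    moreover have "idn G b \<otimes>\<^bsub>ArrGp G\<^esub> (a \<otimes>\<^bsub>ArrGp G\<^esub> a') \<otimes>\<^bsub>ArrGp G\<^esub> inv\<^bsub>ArrGp G\<^esub> (idn G b)
      = idn G b \<otimes>\<^bsub>ArrGp G\<^esub> a \<otimes>\<^bsub>ArrGp G\<^esub> (inv\<^bsub>ArrGp G\<^esub> (idn G b) \<otimes>\<^bsub>ArrGp G\<^esub> idn G b)
        \<otimes>\<^bsub>ArrGp G\<^esub> a' \<otimes>\<^bsub>ArrGp G\<^esub> inv\<^bsub>ArrGp G\<^esub> (idn G b)"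
      using that b
      by (auto simp: mem_ker_d0 Arr.m_assoc Arr.inv_mult_cancel
          simp del: idn.hom_inv Arr.l_inv)
    ultimately show ?thesis
      using that b
      by (simp add: crossed_module_of_simps mem_ker_d0 Arr.m_assoc Arr.inv_mult_cancel
          del: idn.hom_inv)
  qed
  ultimately show ?thesis
    using closed b by (auto simp: auto_def Bij_def hom_def crossed_module_of_simps)
qed

lemma Xact_hom:
  "Xact (crossed_module_of G) \<in> hom (ObGp G) (AutoGroup ((ArrGp G)\<lparr>carrier := ker_d0\<rparr>))"
  using Xact_Auto Xact_mult
  by (auto simp: hom_def AutoGroup_def BijGroup_def carrier_ObGp auto_def)

text \<open>The Peiffer identity. Subtracting the identity at \<open>d1 G a\<close> from
  \<open>a\<close> on the left gives an arrow with target zero, which commutes with \<open>c\<close>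
  by \<open>kernels_commute\<close>; hence \<open>a\<close> and that identity conjugate
  \<open>c\<close> alike.\<close>

lemma Xact_d1:
  assumes a: "a \<in> ker_d0" and c: "c \<in> ker_d0"
  shows "Xact (crossed_module_of G) (d1 G a) c = a \<otimes>\<^bsub>ArrGp G\<^esub> c \<otimes>\<^bsub>ArrGp G\<^esub> inv\<^bsub>ArrGp G\<^esub> a"
proof -
  let ?e = "idn G (d1 G a)" and ?i = "inv\<^bsub>ArrGp G\<^esub> (idn G (d1 G a))"
  note [simp del] = idn.hom_inv
  have ac: "a \<in> Arr G" "c \<in> Arr G" "d0 G c = \<one>\<^bsub>ObGp G\<^esub>" using a c by (auto simp: mem_ker_d0)
  then have "d1 G (?i \<otimes>\<^bsub>ArrGp G\<^esub> a) = \<one>\<^bsub>ObGp G\<^esub>" by (simp add: d1_idn)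
  then have "?i \<otimes>\<^bsub>ArrGp G\<^esub> a \<otimes>\<^bsub>ArrGp G\<^esub> c = c \<otimes>\<^bsub>ArrGp G\<^esub> (?i \<otimes>\<^bsub>ArrGp G\<^esub> a)"
    using ac by (intro kernels_commute) auto
  then have "?e \<otimes>\<^bsub>ArrGp G\<^esub> (?i \<otimes>\<^bsub>ArrGp G\<^esub> a \<otimes>\<^bsub>ArrGp G\<^esub> c) \<otimes>\<^bsub>ArrGp G\<^esub> inv\<^bsub>ArrGp G\<^esub> a
    = ?e \<otimes>\<^bsub>ArrGp G\<^esub> (c \<otimes>\<^bsub>ArrGp G\<^esub> (?i \<otimes>\<^bsub>ArrGp G\<^esub> a)) \<otimes>\<^bsub>ArrGp G\<^esub> inv\<^bsub>ArrGp G\<^esub> a" by simp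
  then show ?thesis
    using ac c by (simp add: crossed_module_of_simps Arr.m_assoc Arr.inv_mult_cancel)
qed

section \<open>Actions and liftings\<close>


definition lifting_of :: "('o, 'm, 'x) gpgpd_action \<Rightarrow> ('m, 'o, 'x) lifting" where
  "lifting_of P = \<lparr>Lphi = \<lambda>a\<in>ker_d0. Gact P a \<one>\<^bsub>GX P\<^esub>, LX = GX P, Lom = Gom P\<rparr>"

text \<open>The default \<open>undefined\<close> makes the action extensional on
  \<open>act_domain\<close>, so that the round trips are equalities and not mere
  isomorphisms.\<close>

definition action_of :: "('m, 'o, 'x) lifting \<Rightarrow> ('o, 'm, 'x) gpgpd_action" where
  "action_of L = \<lparr>GX = LX L, Gom = Lom L,
     Gact = \<lambda>g x. if g \<in> Arr G \<and> x \<in> carrier (LX L) \<and> d0 G g = Lom L x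
       then Lphi L (g \<otimes>\<^bsub>ArrGp G\<^esub> inv\<^bsub>ArrGp G\<^esub> (idn G (Lom L x))) \<otimes>\<^bsub>LX L\<^esub> x
       else undefined\<rparr>"

section \<open>From actions to liftings\<close>

lemma group_hom_Gom:
  assumes "P \<in> gpgpd_actions G"
  shows "group_hom (GX P) (ObGp G) (Gom P)"
  using gpgpd_actionsD[OF assms] by (simp add: group_hom_def group_hom_axioms_def Ob.is_group)

lemma ker_d0_act_domain:
  assumes P: "P \<in> gpgpd_actions G" and a: "a \<in> ker_d0"
  shows "(a, \<one>\<^bsub>GX P\<^esub>) \<in> act_domain G P"
proof -
  interpret om: group_hom "GX P" "ObGp G" "Gom P" by (rule group_hom_Gom[OF P])
  show ?thesis using a by (simp add: act_domain_def mem_ker_d0)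
qed

text \<open>Additivity for the pairs \<open>(g - 1, 0)\<close> and \<open>(1, x)\<close>, whose sum
  is \<open>(g, x)\<close>, together with the identity law. An action is thus determined by its
  values at zero.\<close>

lemma Gact_eq:
  assumes P: "P \<in> gpgpd_actions G" and gx: "(g, x) \<in> act_domain G P"
  shows "Gact P g x
    = Gact P (g \<otimes>\<^bsub>ArrGp G\<^esub> inv\<^bsub>ArrGp G\<^esub> (idn G (Gom P x))) \<one>\<^bsub>GX P\<^esub> \<otimes>\<^bsub>GX P\<^esub> x"
proof -
  interpret om: group_hom "GX P" "ObGp G" "Gom P" by (rule group_hom_Gom[OF P])
  let ?e = "idn G (Gom P x)"
  note [simp del] = idn.hom_inv
  have g: "g \<in> Arr G" "d0 G g = Gom P x" "x \<in> carrier (GX P)" "Gom P x \<in> Ob G"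
    using gx om.hom_closed[of x] by (auto simp: act_domain_def carrier_ObGp)
  then have e: "(?e, x) \<in> act_domain G P" by (simp add: act_domain_def d0_idn)
  have "Gact P (g \<otimes>\<^bsub>ArrGp G\<^esub> inv\<^bsub>ArrGp G\<^esub> ?e) \<one>\<^bsub>GX P\<^esub> \<otimes>\<^bsub>GX P\<^esub> Gact P ?e x
      = Gact P (g \<otimes>\<^bsub>ArrGp G\<^esub> inv\<^bsub>ArrGp G\<^esub> ?e \<otimes>\<^bsub>ArrGp G\<^esub> ?e) (\<one>\<^bsub>GX P\<^esub> \<otimes>\<^bsub>GX P\<^esub> x)"
    by (rule gpgpd_actionsD(9)[OF P ker_d0_act_domain[OF P minus_idn_ker_d0[OF g(1,2)]] e])
  then show ?thesis
    using g by (simp add: gpgpd_actionsD(7)[OF P] Arr.m_assoc)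
qed

text \<open>For equivariance, \<open>x\<close> and \<open>- x\<close> are written as values of
  identity arrows, and additivity merges the three terms into one action on zero. The Peiffer
  identity is that of the given crossed module.\<close>

lemma lifting_of_closed:
  assumes P: "P \<in> gpgpd_actions G"
  shows "lifting_of P \<in> liftings (crossed_module_of G)"
proof -
  interpret om: group_hom "GX P" "ObGp G" "Gom P" by (rule group_hom_Gom[OF P])
  let ?A = "(ArrGp G)\<lparr>carrier := ker_d0\<rparr>" and ?phi = "\<lambda>a\<in>ker_d0. Gact P a \<one>\<^bsub>GX P\<^esub>"
    and ?t = "Xact (crossed_module_of G)"
  note [simp del] = idn.hom_inv
  note dom = ker_d0_act_domain[OF P]
  have phi: "?phi \<in> hom ?A (GX P)"
    using gpgpd_actionsD(5)[OF P dom] gpgpd_actionsD(9)[OF P dom dom]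
    by (simp add: hom_def subgroup.m_closed[OF subgroup_ker_d0])
  have om_phi: "Gom P (?phi a) = d1 G a" if "a \<in> ker_d0" for a
    using gpgpd_actionsD(6)[OF P dom[OF that]] that by simp
  have equiv: "?phi (?t (Gom P x) a)
      = x \<otimes>\<^bsub>GX P\<^esub> ?phi a \<otimes>\<^bsub>GX P\<^esub> inv\<^bsub>GX P\<^esub> x"
    if x: "x \<in> carrier (GX P)" and a: "a \<in> ker_d0" for x a
  proof -
    let ?e = "idn G (Gom P x)"
    have b: "Gom P x \<in> Ob G" using om.hom_closed[OF x] by (simp add: carrier_ObGp)
    have e: "(?e, x) \<in> act_domain G P" using x b by (simp add: act_domain_def d0_idn)
    \<comment> \<open>This exhibits \<open>- ?e\<close> as the identity arrow at
      \<omega>\<open>(- x)\<close>, so that it fixes \<open>- x\<close>.\<close>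
    have inv_e: "inv\<^bsub>ArrGp G\<^esub> ?e = idn G (Gom P (inv\<^bsub>GX P\<^esub> x))"
      using x b by (simp add: idn.hom_inv)
    have e': "(inv\<^bsub>ArrGp G\<^esub> ?e, inv\<^bsub>GX P\<^esub> x) \<in> act_domain G P"
      using x b by (simp add: act_domain_def d0_idn)
    have ea: "(?e \<otimes>\<^bsub>ArrGp G\<^esub> a, x) \<in> act_domain G P"
      using x b a by (simp add: act_domain_def mem_ker_d0 d0_mult d0_idn)
    have "x \<otimes>\<^bsub>GX P\<^esub> Gact P a \<one>\<^bsub>GX P\<^esub> = Gact P (?e \<otimes>\<^bsub>ArrGp G\<^esub> a) x"
      using gpgpd_actionsD(9)[OF P e dom[OF a]] gpgpd_actionsD(7)[OF P x] x by simp
    moreover have "Gact P (inv\<^bsub>ArrGp G\<^esub> ?e) (inv\<^bsub>GX P\<^esub> x) = inv\<^bsub>GX P\<^esub> x"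
      unfolding inv_e using x by (intro gpgpd_actionsD(7)[OF P]) simp
    ultimately have "x \<otimes>\<^bsub>GX P\<^esub> Gact P a \<one>\<^bsub>GX P\<^esub> \<otimes>\<^bsub>GX P\<^esub> inv\<^bsub>GX P\<^esub> x
        = Gact P (?e \<otimes>\<^bsub>ArrGp G\<^esub> a \<otimes>\<^bsub>ArrGp G\<^esub> inv\<^bsub>ArrGp G\<^esub> ?e) \<one>\<^bsub>GX P\<^esub>"
      using gpgpd_actionsD(9)[OF P ea e'] x by simp
    then show ?thesis using a b conj_ker_d0[OF b a] by (simp add: crossed_module_of_simps)
  qed
  have "crossed_module
      \<lparr>XA = ?A, XB = GX P, Xact = (\<lambda>x. ?t (Gom P x)), Xmap = ?phi\<rparr>"
  proof (rule crossed_module.intro, goal_cases)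
    case 1
    show ?case by (simp add: subgroup.subgroup_is_group[OF subgroup_ker_d0 Arr.is_group])
  next
    case 2
    show ?case by (simp add: om.is_group)
  next
    case 3
    show ?case using hom_compose[OF om.homh Xact_hom] by (simp add: comp_def)
  next
    case 4
    show ?case using phi by simp
  next
    case (5 x a)
    then show ?case using equiv[of x a] by simp
  next
    case (6 a c)
    \<comment> \<open>\<open>m_inv_consistent\<close> identifies inverses in the kernel with those
      in \<open>ArrGp G\<close>, in which \<open>Xact_d1\<close> is stated.\<close>
    then show ?case
      using om_phi[of a] Xact_d1[of a c] Arr.m_inv_consistent[OF subgroup_ker_d0] by simp
  qed
  then show ?thesis
    using gpgpd_actionsD(1-3)[OF P] phi om_phi
    by (simp add: liftings_def lifting_of_def crossed_module_of_simps)
qed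

section \<open>From liftings to actions\<close>

lemma group_hom_Lom:
  assumes "L \<in> liftings (crossed_module_of G)"
  shows "group_hom (LX L) (ObGp G) (Lom L)"
  using liftingsD[OF assms]
  by (simp add: group_hom_def group_hom_axioms_def Ob.is_group crossed_module_of_simps)

lemma group_hom_Lphi:
  assumes "L \<in> liftings (crossed_module_of G)"
  shows "group_hom ((ArrGp G)\<lparr>carrier := ker_d0\<rparr>) (LX L) (Lphi L)"
  using liftingsD[OF assms] subgroup.subgroup_is_group[OF subgroup_ker_d0 Arr.is_group]
  by (simp add: group_hom_def group_hom_axioms_def crossed_module_of_simps)

lemma Gact_action_of:
  assumes "(g, x) \<in> act_domain G (action_of L)"
  shows "Gact (action_of L) g x
    = Lphi L (g \<otimes>\<^bsub>ArrGp G\<^esub> inv\<^bsub>ArrGp G\<^esub> (idn G (Lom L x))) \<otimes>\<^bsub>LX L\<^esub> x"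
  using assms by (auto simp: act_domain_def action_of_def)

text \<open>Equivariance of \<phi> in the form of a rule for moving \<open>x\<close> past \<phi>;
  additivity of \<open>action_of L\<close> depends on it.\<close>

lemma Lphi_conj:
  assumes L: "L \<in> liftings (crossed_module_of G)" and x: "x \<in> carrier (LX L)" and a: "a \<in> ker_d0"
  shows "x \<otimes>\<^bsub>LX L\<^esub> Lphi L a
    = Lphi L (idn G (Lom L x) \<otimes>\<^bsub>ArrGp G\<^esub> a \<otimes>\<^bsub>ArrGp G\<^esub> inv\<^bsub>ArrGp G\<^esub> (idn G (Lom L x)))
      \<otimes>\<^bsub>LX L\<^esub> x"
proof -
  interpret phi: group_hom "(ArrGp G)\<lparr>carrier := ker_d0\<rparr>" "LX L" "Lphi L"
    by (rule group_hom_Lphi[OF L])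
  have "Lphi L (Xact (crossed_module_of G) (Lom L x) a)
      = x \<otimes>\<^bsub>LX L\<^esub> Lphi L a \<otimes>\<^bsub>LX L\<^esub> inv\<^bsub>LX L\<^esub> x"
    using crossed_module.equivariance[OF liftingsD(7)[OF L], of x a] x a
    by (simp add: crossed_module_of_simps)
  then have "Lphi L (idn G (Lom L x) \<otimes>\<^bsub>ArrGp G\<^esub> a \<otimes>\<^bsub>ArrGp G\<^esub> inv\<^bsub>ArrGp G\<^esub> (idn G (Lom L x)))
      = x \<otimes>\<^bsub>LX L\<^esub> Lphi L a \<otimes>\<^bsub>LX L\<^esub> inv\<^bsub>LX L\<^esub> x"
    using a by (simp add: crossed_module_of_simps)
  then show ?thesis
    using x a phi.hom_closed[of a] by (simp add: phi.H.m_assoc)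
qed

lemma action_of_closed:
  assumes L: "L \<in> liftings (crossed_module_of G)"
  shows "action_of L \<in> gpgpd_actions G"
proof -
  interpret om: group_hom "LX L" "ObGp G" "Lom L" by (rule group_hom_Lom[OF L])
  interpret phi: group_hom "(ArrGp G)\<lparr>carrier := ker_d0\<rparr>" "LX L" "Lphi L"
    by (rule group_hom_Lphi[OF L])
  let ?P = "action_of L"
  \<comment> \<open>The kernel part of \<open>g\<close>. On the domain \<omega>\<open>(x)\<close>
    equals \<open>d0 G g\<close>, so it can be written without \<open>x\<close>.\<close>
  let ?r = "\<lambda>g. g \<otimes>\<^bsub>ArrGp G\<^esub> inv\<^bsub>ArrGp G\<^esub> (idn G (d0 G g))"
  note [simp del] = idn.hom_inv
  have dom: "(g, x) \<in> act_domain G ?P \<longleftrightarrow> g \<in> Arr G \<and> x \<in> carrier (LX L) \<and> Lom L x = d0 G g"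
    for g x by (auto simp: act_domain_def action_of_def)
  have r: "?r g \<in> ker_d0" if "g \<in> Arr G" for g using minus_idn_ker_d0[OF that] by simp
  have phi_closed: "Lphi L a \<in> carrier (LX L)" if "a \<in> ker_d0" for a
    using phi.hom_closed that by simp
  have phi_mult: "Lphi L (a \<otimes>\<^bsub>ArrGp G\<^esub> c) = Lphi L a \<otimes>\<^bsub>LX L\<^esub> Lphi L c"
    if "a \<in> ker_d0" "c \<in> ker_d0" for a c using phi.hom_mult that by simp
  have om_phi: "Lom L (Lphi L a) = d1 G a" if "a \<in> ker_d0" for a
    using liftingsD(6)[OF L, of a] that by (simp add: crossed_module_of_simps)
  have act: "Gact ?P g x = Lphi L (?r g) \<otimes>\<^bsub>LX L\<^esub> x" if "(g, x) \<in> act_domain G ?P" for g x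
    using Gact_action_of[OF that] that by (simp add: dom)
  have closed: "Gact ?P g x \<in> carrier (LX L)" if "(g, x) \<in> act_domain G ?P" for g x
    using that by (simp add: act) (simp add: dom r phi_closed)
  \<comment> \<open>Here \<omega> of the kernel part is \<open>d1 G g - d0 G g\<close>, and adding
    \<omega>\<open>(x) = d0 G g\<close> cancels.\<close>
  have om_act: "Lom L (Gact ?P g x) = d1 G g" if "(g, x) \<in> act_domain G ?P" for g x
    using that r[of g]
    by (simp add: act) (simp add: dom phi_closed om_phi d1_idn Ob.m_assoc)
  have ident: "Gact ?P (idn G (Lom L x)) x = x" if x: "x \<in> carrier (LX L)" for x
  proof -
    have b: "Lom L x \<in> Ob G" using om.hom_closed[OF x] by (simp add: carrier_ObGp)
    then have "(idn G (Lom L x), x) \<in> act_domain G ?P" using x by (simp add: dom d0_idn)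
    then show ?thesis using x b phi.hom_one by (simp add: act d0_idn)
  qed
  have comp: "Gact ?P (cmp G h g) x = Gact ?P h (Gact ?P g x)"
    if h: "h \<in> Arr G" and gx: "(g, x) \<in> act_domain G ?P" and hg: "d0 G h = d1 G g" for h g x
  proof -
    have g: "g \<in> Arr G" and x: "x \<in> carrier (LX L)" and om: "Lom L x = d0 G g"
      using gx by (auto simp: dom)
    \<comment> \<open>By \<open>cmp_eq_mult\<close>, since the subtracted identities at
      \<open>d0 G h\<close> and \<open>d1 G g\<close> coincide.\<close>
    have "?r (cmp G h g) = ?r h \<otimes>\<^bsub>ArrGp G\<^esub> ?r g"
      using h g hg by (simp add: d0_cmp) (simp add: cmp_eq_mult Arr.m_assoc)
    moreover have "(cmp G h g, x) \<in> act_domain G ?P" "(h, Gact ?P g x) \<in> act_domain G ?P"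
      using h g x om hg gx by (simp_all add: dom d0_cmp cmp_closed closed om_act)
    ultimately show ?thesis
      using gx h g x by (simp add: act r phi_mult phi_closed om.m_assoc)
  qed
  have add: "Gact ?P g x \<otimes>\<^bsub>LX L\<^esub> Gact ?P h y
      = Gact ?P (g \<otimes>\<^bsub>ArrGp G\<^esub> h) (x \<otimes>\<^bsub>LX L\<^esub> y)"
    if gx: "(g, x) \<in> act_domain G ?P" and hy: "(h, y) \<in> act_domain G ?P" for g x h y
  proof -
    have g: "g \<in> Arr G" and x: "x \<in> carrier (LX L)" and om: "Lom L x = d0 G g"
      using gx by (auto simp: dom)
    have h: "h \<in> Arr G" and y: "y \<in> carrier (LX L)" and om': "Lom L y = d0 G h"
      using hy by (auto simp: dom)
    let ?e = "idn G (d0 G g)"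
    let ?c = "?e \<otimes>\<^bsub>ArrGp G\<^esub> ?r h \<otimes>\<^bsub>ArrGp G\<^esub> inv\<^bsub>ArrGp G\<^esub> ?e"
    have c: "?c \<in> ker_d0" using conj_ker_d0 r g h by simp
    \<comment> \<open>The kernel part is not additive: that of \<open>h\<close> gets conjugated by
      the identity at \<open>d0 G g\<close>, which \<open>Lphi_conj\<close> undoes below.\<close>
    have "?r (g \<otimes>\<^bsub>ArrGp G\<^esub> h) = ?r g \<otimes>\<^bsub>ArrGp G\<^esub> ?c"
      using g h by (simp add: d0_mult Arr.inv_mult_group Arr.m_assoc Arr.inv_mult_cancel)
    then have "Gact ?P (g \<otimes>\<^bsub>ArrGp G\<^esub> h) (x \<otimes>\<^bsub>LX L\<^esub> y)
        = Lphi L (?r g) \<otimes>\<^bsub>LX L\<^esub> (Lphi L ?c \<otimes>\<^bsub>LX L\<^esub> x) \<otimes>\<^bsub>LX L\<^esub> y"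
      using g h x y om om' c r phi_closed
      by (simp add: act dom d0_mult phi_mult om.m_assoc)
    also have "Lphi L ?c \<otimes>\<^bsub>LX L\<^esub> x = x \<otimes>\<^bsub>LX L\<^esub> Lphi L (?r h)"
      using Lphi_conj[OF L x r[OF h]] om by simp
    finally show ?thesis
      using g h x y r phi_closed gx hy by (simp add: act om.m_assoc)
  qed
  have sel: "GX ?P = LX L" "Gom ?P = Lom L" by (simp_all add: action_of_def)
  have "case_prod (Gact ?P) \<in> act_domain G ?P \<rightarrow>\<^sub>E carrier (LX L)"
    using closed by (auto simp: PiE_def extensional_def) (auto simp: act_domain_def action_of_def)
  then show ?thesis
    using liftingsD(1-3)[OF L] om_act ident comp add
    by (simp add: gpgpd_actions_def sel crossed_module_of_simps split_beta)
qed

section \<open>The constructions are mutually inverse and have the same morphisms\<close>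

lemma action_of_lifting_of:
  assumes P: "P \<in> gpgpd_actions G"
  shows "action_of (lifting_of P) = P"
proof -
  have "Gact (action_of (lifting_of P)) g x = Gact P g x" for g x
  proof (cases "(g, x) \<in> act_domain G P")
    case True
    then have "g \<otimes>\<^bsub>ArrGp G\<^esub> inv\<^bsub>ArrGp G\<^esub> (idn G (Gom P x)) \<in> ker_d0"
      by (intro minus_idn_ker_d0) (auto simp: act_domain_def)
    with True show ?thesis
      using Gact_eq[OF P True] by (auto simp: act_domain_def action_of_def lifting_of_def)
  next
    case False
    \<comment> \<open>Off the domain both sides take the same default value.\<close>
    then have "Gact P g x = undefined"
      using PiE_arb[OF gpgpd_actionsD(4)[OF P] False] by simp
    with False show ?thesis
      by (auto simp: act_domain_def action_of_def lifting_of_def)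
  qed
  then show ?thesis
    by (auto intro!: gpgpd_action.equality simp: action_of_def lifting_of_def fun_eq_iff)
qed

lemma lifting_of_action_of:
  assumes L: "L \<in> liftings (crossed_module_of G)"
  shows "lifting_of (action_of L) = L"
proof -
  interpret om: group_hom "LX L" "ObGp G" "Lom L" by (rule group_hom_Lom[OF L])
  interpret phi: group_hom "(ArrGp G)\<lparr>carrier := ker_d0\<rparr>" "LX L" "Lphi L"
    by (rule group_hom_Lphi[OF L])
  have "Lphi (lifting_of (action_of L)) a = Lphi L a" for a
  proof (cases "a \<in> ker_d0")
    case True
    \<comment> \<open>The identity subtracted lies over \<omega>\<open>(0) = 0\<close>, so it is the
      zero arrow.\<close>
    then show ?thesis
      using phi.hom_closed[of a] by (simp add: lifting_of_def action_of_def mem_ker_d0)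
  next
    case False
    then show ?thesis
      using liftingsD(5)[OF L] by (simp add: lifting_of_def crossed_module_of_simps extensional_def)
  qed
  then show ?thesis
    by (auto intro!: lifting.equality simp: action_of_def lifting_of_def fun_eq_iff)
qed

text \<open>A homomorphism fixes zero, so preserving the action implies preserving \<phi>.
  Conversely, \<open>Gact_eq\<close> expresses both actions through \<phi>, and compatibility with
  \<omega> makes the kernel part of \<open>g\<close> the same at \<open>x\<close> and at
  \<open>f x\<close>.\<close>

lemma lifting_hom_lifting_of:
  assumes P: "P \<in> gpgpd_actions G" and Q: "Q \<in> gpgpd_actions G"
  shows "lifting_hom (crossed_module_of G) (lifting_of P) (lifting_of Q) = gpgpd_action_hom G P Q"
proof -
  have one: "f \<one>\<^bsub>GX P\<^esub> = \<one>\<^bsub>GX Q\<^esub>" if "f \<in> hom (GX P) (GX Q)" for f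
    using that hom_one gpgpd_actionsD(1) P Q by blast
  have phi: "f (Gact P a \<one>\<^bsub>GX P\<^esub>) = Gact Q a \<one>\<^bsub>GX Q\<^esub>"
    if "f \<in> hom (GX P) (GX Q)" "\<forall>(g, x)\<in>act_domain G P. f (Gact P g x) = Gact Q g (f x)"
      "a \<in> ker_d0" for f a
    using bspec[OF that(2) ker_d0_act_domain[OF P that(3)]] one[OF that(1)] by simp
  have act: "f (Gact P g x) = Gact Q g (f x)"
    if f: "f \<in> hom (GX P) (GX Q)" and gx: "(g, x) \<in> act_domain G P"
      and phi: "\<forall>a\<in>ker_d0. f (Gact P a \<one>\<^bsub>GX P\<^esub>) = Gact Q a \<one>\<^bsub>GX Q\<^esub>"
      and om: "\<forall>x\<in>carrier (GX P). Gom Q (f x) = Gom P x" for f g x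
  proof -
    let ?a = "g \<otimes>\<^bsub>ArrGp G\<^esub> inv\<^bsub>ArrGp G\<^esub> (idn G (Gom P x))"
    have x: "x \<in> carrier (GX P)" and a: "?a \<in> ker_d0"
      using gx minus_idn_ker_d0 by (auto simp: act_domain_def)
    have gfx: "(g, f x) \<in> act_domain G Q"
      using gx f om x by (auto simp: act_domain_def hom_def)
    have "f (Gact P g x) = f (Gact P ?a \<one>\<^bsub>GX P\<^esub>) \<otimes>\<^bsub>GX Q\<^esub> f x"
      using Gact_eq[OF P gx]
        hom_mult[OF f gpgpd_actionsD(5)[OF P ker_d0_act_domain[OF P a]] x] by simp
    also have "\<dots> = Gact Q g (f x)"
      using Gact_eq[OF Q gfx] phi a om x by simp
    finally show ?thesis .
  qed
  then show ?thesis
    by (auto simp: lifting_hom_def gpgpd_action_hom_def lifting_of_def crossed_module_of_simps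
        intro: phi act)
qed

end

theorem theorem5p1:
  fixes G :: "('o, 'm) group_groupoid"
  assumes "group_groupoid G"
  shows "equivalent_categories
    (GpGpdAct G :: (('o, 'm, 'x) gpgpd_action,
      ('o, 'm, 'x) gpgpd_action \<times> ('x \<Rightarrow> 'x) \<times> ('o, 'm, 'x) gpgpd_action) category)
    (LXMod (crossed_module_of G) :: (('m, 'o, 'x) lifting,
      ('m, 'o, 'x) lifting \<times> ('x \<Rightarrow> 'x) \<times> ('m, 'o, 'x) lifting) category)"
proof -
  interpret group_groupoid G by fact
  \<comment> \<open>The goal left for the last \<open>simp\<close> is that \<open>lifting_of\<close>
    keeps the carrier.\<close>
  show ?thesis
    unfolding GpGpdAct_def LXMod_def
    by (rule equivalent_concrete_categories[where Fo = lifting_of and Ho = action_of,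
          OF category_GpGpdAct[unfolded GpGpdAct_def] category_LXMod[unfolded LXMod_def]])
      (simp_all add: lifting_of_closed action_of_closed action_of_lifting_of lifting_of_action_of
        lifting_hom_lifting_of, simp add: lifting_of_def)
qed

end
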